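(* For any diversity $(X,\delta)$, the tight span $(T_X,\delta_T)$ is a hyperconvex diversity.
   Context: For a set $X$, $\mathcal{P}_{\mathrm{fin}}(X)$ denotes the set of all finite subsets of $X$. A diversity is a pair $(X,\delta)$ where $X$ is a set and $\delta:\mathcal{P}_{\mathrm{fin}}(X)\to\mathbb{R}$ satisfies, for all finite $A,B,C\subseteq X$: (D1) $\delta(A)\ge 0$, and $\delta(A)=0$ if and only if $|A|\le 1$; (D2) if $B\ne\emptyset$ then $\delta(A\cup C)\le\delta(A\cup B)+\delta(B\cup C)$. Given a diversity $(X,\delta)$, $P_X$ is the set of all functions $f:\mathcal{P}_{\mathrm{fin}}(X)\to\mathbb{R}$ with $f(\emptyset)=0$ and $\sum_{A\in\mathscr{A}}f(A)\ge\delta\big(\bigcup_{A\in\mathscr{A}}A\big)$ for all finite $\mathscr{A}\subseteq\mathcal{P}_{\mathrm{fin}}(X)$. Write $f\preceq g$ if $f(A)\le g(A)$ for all finite $A\subseteq X$. The tight span $T_X$ is the set of elements of $P_X$ that are minimal with respect to $\preceq$. The function $\delta_T:\mathcal{P}_{\mathrm{fin}}(T_X)\to\mathbb{R}$ is defined by $\delta_T(\emptyset)=0$ and, for finite non-empty $F\subseteq T_X$, $$\delta_T(F)=\sup\left\{\delta\Big(\bigcup_{A\in\mathscr{A}}A\Big)-\sum_{A\in\mathscr{A}}\inf_{f\in F}f(A):\ \mathscr{A}\subseteq\mathcal{P}_{\mathrm{fin}}(X),\ |\mathscr{A}|<\infty\right\}.$$ The pair $(T_X,\delta_T)$ is a diversity.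 A diversity $(X,\delta)$ is hyperconvex if for all $r:\mathcal{P}_{\mathrm{fin}}(X)\to\mathbb{R}$ such that $\delta\big(\bigcup_{A\in\mathscr{A}}A\big)\le\sum_{A\in\mathscr{A}}r(A)$ for all finite $\mathscr{A}\subseteq\mathcal{P}_{\mathrm{fin}}(X)$, there is $z\in X$ such that $\delta(\{z\}\cup Y)\le r(Y)$ for all finite $Y\subseteq X$. *)

theory Defs
  imports Complex_Main "HOL-Library.FuncSet"
begin

text \<open>
  Finite subsets of the carrier \<open>X\<close> form \<open>Fpow X\<close>; only the values of \<open>\<delta>\<close> on \<open>Fpow X\<close> matter.
\<close>

definition diversity :: "'a set \<Rightarrow> ('a set \<Rightarrow> real) \<Rightarrow> bool" where
  "diversity X \<delta> \<longleftrightarrow>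
     (\<forall>A\<in>Fpow X. \<delta> A \<ge> 0 \<and> (\<delta> A = 0 \<longleftrightarrow> card A \<le> 1)) \<and>
     (\<forall>A\<in>Fpow X. \<forall>B\<in>Fpow X. \<forall>C\<in>Fpow X.
        B \<noteq> {} \<longrightarrow> \<delta> (A \<union> C) \<le> \<delta> (A \<union> B) + \<delta> (B \<union> C))"

text \<open>
  Functions on \<open>Fpow X\<close> are represented by total functions that are \<open>undefined\<close> outside \<open>Fpow X\<close>,
  so that equality in the type \<open>'a set \<Rightarrow> real\<close> is equality of functions on \<open>Fpow X\<close>.
\<close>

definition div_P :: "'a set \<Rightarrow> ('a set \<Rightarrow> real) \<Rightarrow> ('a set \<Rightarrow> real) set" where
  "div_P X \<delta> = {f \<in> extensional (Fpow X).
     f {} = 0 \<and> (\<forall>\<A>. finite \<A> \<and> \<A> \<subseteq> Fpow X \<longrightarrow> (\<Sum>A\<in>\<A>. f A) \<ge> \<delta> (\<Union>\<A>))}"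

definition div_le :: "'a set \<Rightarrow> ('a set \<Rightarrow> real) \<Rightarrow> ('a set \<Rightarrow> real) \<Rightarrow> bool" where
  "div_le X f g \<longleftrightarrow> (\<forall>A\<in>Fpow X. f A \<le> g A)"

definition tight_span :: "'a set \<Rightarrow> ('a set \<Rightarrow> real) \<Rightarrow> ('a set \<Rightarrow> real) set" where
  "tight_span X \<delta> = {f \<in> div_P X \<delta>. \<forall>g\<in>div_P X \<delta>. div_le X g f \<longrightarrow> g = f}"

definition tight_span_div ::
    "'a set \<Rightarrow> ('a set \<Rightarrow> real) \<Rightarrow> ('a set \<Rightarrow> real) set \<Rightarrow> real" where
  "tight_span_div X \<delta> F =
     (if F = {} then 0
      else (SUP \<A>\<in>{\<A>. finite \<A> \<and> \<A> \<subseteq> Fpow X}.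
              \<delta> (\<Union>\<A>) - (\<Sum>A\<in>\<A>. INF f\<in>F. f A)))"

definition hyperconvex :: "'a set \<Rightarrow> ('a set \<Rightarrow> real) \<Rightarrow> bool" where
  "hyperconvex X \<delta> \<longleftrightarrow>
     (\<forall>r :: 'a set \<Rightarrow> real.
        (\<forall>\<A>. finite \<A> \<and> \<A> \<subseteq> Fpow X \<longrightarrow> \<delta> (\<Union>\<A>) \<le> (\<Sum>A\<in>\<A>. r A)) \<longrightarrow>
        (\<exists>z\<in>X. \<forall>Y\<in>Fpow X. \<delta> ({z} \<union> Y) \<le> r Y))"

text \<open>
  The real-valued supremum in \<open>tight_span_div\<close> is a genuine one: it ranges over a set that is
  bounded above (and non-empty, as \<open>\<A> = {}\<close> is allowed).
\<close>

lemma div_P_choice_bound: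
  assumes div: "diversity X \<delta>" and x: "x \<in> X" and "finite G" "G \<subseteq> div_P X \<delta>"
    and "finite \<A>" "\<A> \<subseteq> Fpow X" "s ` \<A> \<subseteq> G"
  shows "\<delta> (insert x (\<Union>\<A>)) \<le> (\<Sum>A\<in>\<A>. s A A) + (\<Sum>g\<in>G. g {x})"
  using assms(3-)
proof (induction G arbitrary: \<A> rule: finite_induct)
  case empty
  then show ?case using div x by (auto simp: diversity_def Fpow_def)
next
  case (insert g G)
  define B where "B = {A\<in>\<A>. s A = g}"
  define C where "C = \<A> - B"
  have BC: "\<A> = B \<union> C" "B \<inter> C = {}" "finite B" "finite C" "B \<subseteq> Fpow X" "C \<subseteq> Fpow X"
    "s ` C \<subseteq> G"
    using insert.prems by (auto simp: B_def C_def)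
  have un: "\<Union>B \<in> Fpow X" "\<Union>C \<in> Fpow X" "{x} \<in> Fpow X"
    using BC x by (auto simp: Fpow_def)
  have g: "\<delta> (\<Union>\<B>) \<le> sum g \<B>" if "finite \<B>" "\<B> \<subseteq> Fpow X" for \<B>
    using insert.prems(1) that by (auto simp: div_P_def)
  have "0 \<le> \<delta> {x}" using div un(3) by (auto simp: diversity_def)
  also have "\<dots> \<le> g {x}" using g[of "{{x}}"] un by simp
  finally have g0: "0 \<le> g {x}" .
  have 1: "\<delta> (insert x (\<Union>B)) \<le> (\<Sum>A\<in>B. g A) + g {x}"
  proof (cases "{x} \<in> B")
    case True
    then have "insert x (\<Union>B) = \<Union>B" by auto
    then show ?thesis using g[of B] BC g0 by simp
  next
    case False
    then show ?thesis using g[of "insert {x} B"] BC un by simp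
  qed
  have 2: "\<delta> (insert x (\<Union>C)) \<le> (\<Sum>A\<in>C. s A A) + (\<Sum>g\<in>G. g {x})"
    using insert.IH[of C] insert.prems BC by auto
  have "insert x (\<Union>B) \<in> Fpow X" using un by (auto simp: Fpow_def)
  then have "\<delta> (insert x (\<Union>B) \<union> \<Union>C) \<le> \<delta> (insert x (\<Union>B) \<union> {x}) + \<delta> ({x} \<union> \<Union>C)"
    using div un unfolding diversity_def by blast
  moreover have "insert x (\<Union>B) \<union> \<Union>C = insert x (\<Union>\<A>)" using BC by auto
  moreover have "(\<Sum>A\<in>\<A>. s A A) = (\<Sum>A\<in>B. g A) + (\<Sum>A\<in>C. s A A)"
    using BC by (simp add: sum.union_disjoint) (simp add: B_def)
  ultimately show ?case using 1 2 insert.hyps by simp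
qed

lemma tight_span_div_bdd_above:
  assumes div: "diversity X \<delta>" and F: "finite F" "F \<noteq> {}" "F \<subseteq> div_P X \<delta>"
  shows "bdd_above ((\<lambda>\<A>. \<delta> (\<Union>\<A>) - (\<Sum>A\<in>\<A>. INF f\<in>F. f A)) ` {\<A>. finite \<A> \<and> \<A> \<subseteq> Fpow X})"
proof (cases "X = {}")
  case True
  then have "{\<A>. finite \<A> \<and> \<A> \<subseteq> Fpow X} \<subseteq> Pow {{}}" by (auto simp: Fpow_def)
  then have "finite {\<A>. finite \<A> \<and> \<A> \<subseteq> Fpow X}" by (rule finite_subset) simp
  then show ?thesis by (intro bdd_above_finite finite_imageI)
next
  case False
  then obtain x where x: "x \<in> X" by blast
  have "\<exists>f\<in>F. (INF f\<in>F. f A) = f A" for A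
  proof -
    have "Min ((\<lambda>f. f A) ` F) \<in> (\<lambda>f. f A) ` F" using F by (intro Min_in) auto
    moreover have "(INF f\<in>F. f A) = Min ((\<lambda>f. f A) ` F)" using F by (intro cInf_eq_Min) auto
    ultimately show ?thesis by (metis (no_types, lifting) imageE)
  qed
  then obtain s where s: "\<And>A. s A \<in> F" "\<And>A. (INF f\<in>F. f A) = s A A" by metis
  show ?thesis
  proof (rule bdd_aboveI2)
    fix \<A> assume "\<A> \<in> {\<A>. finite \<A> \<and> \<A> \<subseteq> Fpow X}"
    then have A: "finite \<A>" "\<A> \<subseteq> Fpow X" by auto
    then have un: "\<Union>\<A> \<in> Fpow X" "{x} \<in> Fpow X" "{} \<in> Fpow X" using x by (auto simp: Fpow_def)
    then have "\<delta> (\<Union>\<A> \<union> {}) \<le> \<delta> (\<Union>\<A> \<union> {x}) + \<delta> ({x} \<union> {})"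
      using div unfolding diversity_def by blast
    moreover have "\<delta> {x} = 0" using div un by (auto simp: diversity_def)
    moreover have "\<delta> (insert x (\<Union>\<A>)) \<le> (\<Sum>A\<in>\<A>. s A A) + (\<Sum>g\<in>F. g {x})"
      using div_P_choice_bound[OF div x F(1,3) A, of s] s by blast
    ultimately show "\<delta> (\<Union>\<A>) - (\<Sum>A\<in>\<A>. INF f\<in>F. f A) \<le> (\<Sum>g\<in>F. g {x})"
      using s by simp
  qed
qed

end

theory Submission
  imports Defs
begin

text \<open>
  An element \<open>f\<close> of \<open>P\<^sub>X\<close> is best read as a price list: a finite family of finite sets may not be
  bought for less than the diversity of its union.  Families priced by different elements can be
  merged, since prices are non-negative and a repeated set then costs no more than before; this
  bounds \<open>\<delta>\<^sub>T\<close> of a union from below (\<open>tight_span_div_ge_family\<close>).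

  That \<open>\<delta>\<^sub>T F = 0\<close> forces \<open>card F \<le> 1\<close> is minimality: the pointwise minimum of \<open>F\<close> is then in \<open>P\<^sub>X\<close>.

  For the triangle inequality it suffices, as \<open>\<delta>\<^sub>T\<close> is monotone, to pass through a single point \<open>g\<close>
  of the tight span.
  An element \<open>g\<close> of the tight span is tight: \<open>g A\<close> is the supremum of
  \<open>\<delta> (A \<union> \<Union>\<D>) - sum g \<D>\<close>, since otherwise \<open>g A\<close> could be lowered (\<open>tight_span_approx\<close>).
  A family witnessing \<open>\<delta>\<^sub>T (F \<union> H)\<close> splits into a part \<open>\<B>\<close> priced by \<open>F\<close> and a part \<open>\<C>\<close> priced by \<open>H\<close>.
  Adding the set \<open>\<Union>\<B>\<close>, priced by \<open>g\<close>, to \<open>\<C>\<close> gives a family for \<open>\<delta>\<^sub>T (H \<union> {g})\<close> with the same union;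
  tightness gives a \<open>\<D>\<close>, priced by \<open>g\<close>, such that \<open>\<B> \<union> \<D>\<close> recovers the extra cost \<open>g (\<Union>\<B>)\<close>
  in \<open>\<delta>\<^sub>T (F \<union> {g})\<close>, up to an arbitrarily small error.

  For hyperconvexity, let \<open>r\<close> be admissible on the tight span and let \<open>\<rho> D\<close> be the cheapest way to
  pay for \<open>D\<close>: choose a finite non-empty \<open>F\<close>, pay \<open>r F\<close>, and then pay the lowest price in \<open>F\<close> for
  each member of a finite family with union \<open>D\<close>.  Admissibility of \<open>r\<close> ensures that \<open>\<rho>\<close>
  lies in \<open>P\<^sub>X\<close> (\<open>cover_cost_in_div_P\<close>).  By Zorn's lemma some \<open>z\<close> in the tight span lies below
  \<open>\<rho>\<close>, and every such \<open>z\<close> is the required point: a family \<open>\<B> \<union> \<C>\<close> with \<open>\<B>\<close> priced by \<open>z\<close> and \<open>\<C>\<close>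
  priced by \<open>F\<close> satisfies \<open>\<delta> (\<Union>\<B> \<union> \<Union>\<C>) \<le> sum z \<B> + z (\<Union>\<C>)\<close>, and
  \<open>z (\<Union>\<C>) \<le> \<rho> (\<Union>\<C>)\<close> is at most the price of \<open>\<C>\<close> plus \<open>r F\<close>.
\<close>

section \<open>Pointwise minima and finite sums\<close>

abbreviation lowest :: "('a set \<Rightarrow> real) set \<Rightarrow> 'a set \<Rightarrow> real" where
  "lowest F A \<equiv> (INF f\<in>F. f A)"

text \<open>
  The function \<open>\<rho>\<close> above, for \<open>T\<close> the tight span.  For \<open>D \<noteq> {}\<close> the infimum ranges over a set bounded below by \<open>0\<close> whenever \<open>r\<close> is admissible;
  the value at \<open>{}\<close> is set to \<open>0\<close>, as membership in \<open>P\<^sub>X\<close> demands.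
\<close>

definition cover_cost ::
    "'a set \<Rightarrow> ('a set \<Rightarrow> real) set \<Rightarrow> (('a set \<Rightarrow> real) set \<Rightarrow> real) \<Rightarrow> 'a set \<Rightarrow> real" where
  "cover_cost X T r = restrict (\<lambda>D. if D = {} then 0 else
     (INF (F, \<C>) \<in> {(F, \<C>). F \<in> Fpow T \<and> F \<noteq> {} \<and> \<C> \<in> Fpow (Fpow X) \<and> \<Union>\<C> = D}.
        r F + sum (lowest F) \<C>)) (Fpow X)"

lemma Fpow_iff: "A \<in> Fpow S \<longleftrightarrow> finite A \<and> A \<subseteq> S"
  by (auto simp: Fpow_def)

lemma Fpow_finite: "A \<in> Fpow S \<Longrightarrow> finite A"
  by (simp add: Fpow_iff)

lemma Fpow_memD: "A \<in> Fpow S \<Longrightarrow> x \<in> A \<Longrightarrow> x \<in> S"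
  by (auto simp: Fpow_iff)

lemma sum_restrict_Fpow: "A \<in> Fpow S \<Longrightarrow> sum (restrict f S) A = sum f A"
  by (intro sum.cong) (auto dest: Fpow_memD)

lemma Union_Fpow: "\<A> \<in> Fpow (Fpow S) \<Longrightarrow> \<Union>\<A> \<in> Fpow S"
  by (auto simp: Fpow_def)

lemma lowest_in:
  assumes "finite F" "F \<noteq> {}"
  shows "\<exists>f\<in>F. lowest F A = f A"
proof -
  have "Min ((\<lambda>f. f A) ` F) \<in> (\<lambda>f. f A) ` F" using assms by (intro Min_in) auto
  moreover have "lowest F A = Min ((\<lambda>f. f A) ` F)" using assms by (intro cInf_eq_Min) auto
  ultimately show ?thesis by (metis (no_types, lifting) imageE)
qed

lemma lowest_le: "finite F \<Longrightarrow> f \<in> F \<Longrightarrow> lowest F A \<le> f A"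
  by (intro cINF_lower bdd_below_finite) auto

lemma lowest_antimono:
  "finite G \<Longrightarrow> F \<noteq> {} \<Longrightarrow> F \<subseteq> G \<Longrightarrow> lowest G A \<le> lowest F A"
  using lowest_in[of F A] lowest_le[of G _ A] by (metis finite_subset subsetD)

lemma lowest_Un:
  assumes "finite F" "finite G" "F \<noteq> {}" "G \<noteq> {}"
  shows "lowest (F \<union> G) A = min (lowest F A) (lowest G A)"
proof (rule antisym)
  show "lowest (F \<union> G) A \<le> min (lowest F A) (lowest G A)"
    using assms by (auto intro!: lowest_antimono)
  obtain f where "f \<in> F \<union> G" "lowest (F \<union> G) A = f A"
    using lowest_in[of "F \<union> G" A] assms by auto
  then show "min (lowest F A) (lowest G A) \<le> lowest (F \<union> G) A"
    using lowest_le[of F f A] lowest_le[of G f A] assms by auto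
qed

text \<open>
  Splits an error \<open>e\<close> evenly; the extra \<open>1\<close> keeps the share positive when \<open>A\<close> is empty.
\<close>

lemma sum_add_fraction_le:
  fixes f :: "'b \<Rightarrow> real"
  assumes "e > 0"
  shows "(\<Sum>a\<in>A. f a + e / (real (card A) + 1)) \<le> sum f A + e"
proof -
  have "real (card A) * (e / (real (card A) + 1)) \<le> e"
    using assms by (simp add: field_simps)
  then show ?thesis by (simp add: sum.distrib)
qed

lemma sum_UNION_le:
  fixes h :: "'b \<Rightarrow> real"
  assumes "finite I" "\<And>i. i \<in> I \<Longrightarrow> finite (C i)" "\<And>i c. i \<in> I \<Longrightarrow> c \<in> C i \<Longrightarrow> 0 \<le> h c"
  shows "sum h (\<Union>i\<in>I. C i) \<le> (\<Sum>i\<in>I. sum h (C i))"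
proof -
  have "sum h (snd ` Sigma I C) \<le> sum (h \<circ> snd) (Sigma I C)"
    using assms by (intro sum_image_le) auto
  also have "\<dots> = (\<Sum>i\<in>I. sum h (C i))"
    using assms by (subst sum.Sigma) (auto simp: split_def)
  also have "snd ` Sigma I C = (\<Union>i\<in>I. C i)" by force
  finally show ?thesis .
qed

context
  fixes X :: "'a set" and \<delta> :: "'a set \<Rightarrow> real"
  assumes div: "diversity X \<delta>"
begin

section \<open>Elements of the tight span\<close>

lemma \<delta>_nonneg: "A \<in> Fpow X \<Longrightarrow> 0 \<le> \<delta> A"
  using div by (auto simp: diversity_def)

lemma \<delta>_eq_0_iff: "A \<in> Fpow X \<Longrightarrow> \<delta> A = 0 \<longleftrightarrow> card A \<le> 1"
  using div by (auto simp: diversity_def)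

lemma \<delta>_triangle:
  "A \<in> Fpow X \<Longrightarrow> B \<in> Fpow X \<Longrightarrow> C \<in> Fpow X \<Longrightarrow> B \<noteq> {} \<Longrightarrow> \<delta> (A \<union> C) \<le> \<delta> (A \<union> B) + \<delta> (B \<union> C)"
  using div unfolding diversity_def by blast

lemma \<delta>_empty: "\<delta> {} = 0"
  using \<delta>_eq_0_iff[of "{}"] by (auto simp: Fpow_iff)

lemma div_P_bound: "f \<in> div_P X \<delta> \<Longrightarrow> \<A> \<in> Fpow (Fpow X) \<Longrightarrow> \<delta> (\<Union>\<A>) \<le> sum f \<A>"
  by (auto simp: div_P_def Fpow_iff)

lemma div_P_I:
  assumes "f \<in> extensional (Fpow X)" "f {} = 0"
    "\<And>\<A>. \<A> \<in> Fpow (Fpow X) \<Longrightarrow> \<delta> (\<Union>\<A>) \<le> sum f \<A>"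
  shows "f \<in> div_P X \<delta>"
  using assms by (auto simp: div_P_def Fpow_iff)

lemma div_P_nonneg: "f \<in> div_P X \<delta> \<Longrightarrow> A \<in> Fpow X \<Longrightarrow> 0 \<le> f A"
  using div_P_bound[of f "{A}"] \<delta>_nonneg[of A] by (auto simp: Fpow_iff)

text \<open>
  If \<open>X\<close> has a point \<open>x\<close>, the prices \<open>\<delta> (A \<union> {x})\<close> will do: sets that share \<open>x\<close> can be joined one at
  a time by the triangle inequality through \<open>{x}\<close>.  This is the usual embedding of \<open>X\<close> into its
  tight span.
\<close>

lemma div_P_nonempty: "div_P X \<delta> \<noteq> {}"
proof (cases "X = {}")
  case True
  have "restrict (\<lambda>_. 0) (Fpow X) \<in> div_P X \<delta>"
  proof (rule div_P_I)
    fix \<A> :: "'a set set" assume "\<A> \<in> Fpow (Fpow X)"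
    then have "\<Union>\<A> = {}" using True by (auto simp: Fpow_iff)
    moreover have "sum (restrict (\<lambda>_. 0) (Fpow X)) \<A> = (0::real)"
      using \<open>\<A> \<in> Fpow (Fpow X)\<close> by (subst sum_restrict_Fpow) auto
    ultimately show "\<delta> (\<Union>\<A>) \<le> sum (restrict (\<lambda>_. 0) (Fpow X)) \<A>"
      using \<delta>_empty by (metis order_refl)
  qed (auto simp: Fpow_iff)
  then show ?thesis by blast
next
  case False
  then obtain x where x: "x \<in> X" by blast
  have x0: "\<delta> {x} = 0" using \<delta>_eq_0_iff[of "{x}"] x by (simp add: Fpow_iff)
  have star: "\<delta> (insert x (\<Union>\<A>)) \<le> (\<Sum>A\<in>\<A>. \<delta> (insert x A))"
    if "finite \<A>" "\<A> \<subseteq> Fpow X" for \<A>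
    using that
  proof (induction rule: finite_induct)
    case empty
    then show ?case using x0 by simp
  next
    case (insert A \<A>)
    have "\<Union>\<A> \<in> Fpow X" using insert by (intro Union_Fpow) (simp add: Fpow_iff)
    then have fp: "insert x A \<in> Fpow X" "insert x (\<Union>\<A>) \<in> Fpow X" "{x} \<in> Fpow X"
      using insert.prems x by (auto simp: Fpow_iff)
    from \<delta>_triangle[OF fp(1,3,2)] insert show ?case
      by (simp add: insert_commute Un_assoc)
  qed
  have "restrict (\<lambda>A. \<delta> (insert x A)) (Fpow X) \<in> div_P X \<delta>"
  proof (rule div_P_I)
    fix \<A> :: "'a set set" assume A: "\<A> \<in> Fpow (Fpow X)"
    then have "\<delta> (\<Union>\<A>) \<le> \<delta> (insert x (\<Union>\<A>)) + \<delta> {x}"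
      using \<delta>_triangle[of "\<Union>\<A>" "{x}" "{}"] Union_Fpow[OF A] x by (simp add: Fpow_iff)
    also have "\<dots> \<le> (\<Sum>A\<in>\<A>. \<delta> (insert x A))" using star[of \<A>] A x0 by (simp add: Fpow_iff)
    also have "\<dots> = sum (restrict (\<lambda>A. \<delta> (insert x A)) (Fpow X)) \<A>"
      by (rule sum_restrict_Fpow[OF A, symmetric])
    finally show "\<delta> (\<Union>\<A>) \<le> sum (restrict (\<lambda>A. \<delta> (insert x A)) (Fpow X)) \<A>" .
  qed (auto simp: Fpow_iff x0)
  then show ?thesis by blast
qed

text \<open>
  The condition defining \<open>P\<^sub>X\<close> involves finitely many values at a time, and in a chain finitely many
  values can be brought close to their infima by one single member.
\<close>

lemma chain_Inf_in_div_P: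
  assumes C: "C \<subseteq> div_P X \<delta>" "C \<noteq> {}" "\<And>f g. f \<in> C \<Longrightarrow> g \<in> C \<Longrightarrow> div_le X f g \<or> div_le X g f"
  shows "restrict (lowest C) (Fpow X) \<in> div_P X \<delta>"
proof (rule div_P_I)
  have *: "\<exists>g\<in>C. \<forall>A\<in>\<A>. g A \<le> lowest C A + e"
    if "finite \<A>" "\<A> \<subseteq> Fpow X" "e > 0" for \<A> e
    using that(1,2)
  proof (induction rule: finite_induct)
    case empty
    then show ?case using C by auto
  next
    case (insert A \<A>)
    then obtain g where g: "g \<in> C" "\<forall>A\<in>\<A>. g A \<le> lowest C A + e" by auto
    have "\<exists>y\<in>(\<lambda>f. f A) ` C. y < lowest C A + e"
      using C \<open>e > 0\<close> by (intro cInf_lessD) auto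
    then obtain h where h: "h \<in> C" "h A \<le> lowest C A + e" by force
    consider "div_le X g h" | "div_le X h g" using C(3) g h by blast
    then show ?case
    proof cases
      case 1
      then have "g A \<le> h A" using insert.prems by (auto simp: div_le_def)
      then show ?thesis using g h by (intro bexI[of _ g]) auto
    next
      case 2
      then have "\<forall>A\<in>\<A>. h A \<le> g A" using insert.prems by (auto simp: div_le_def)
      then show ?thesis using g h by (intro bexI[of _ h]) force+
    qed
  qed
  fix \<A> :: "'a set set" assume A: "\<A> \<in> Fpow (Fpow X)"
  have "\<delta> (\<Union>\<A>) \<le> sum (lowest C) \<A>"
  proof (rule field_le_epsilon)
    fix e :: real assume "e > 0"
    then obtain g where g: "g \<in> C" "\<forall>A\<in>\<A>. g A \<le> lowest C A + e / (real (card \<A>) + 1)"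
      using *[of \<A> "e / (real (card \<A>) + 1)"] A by (auto simp: Fpow_iff)
    have "\<delta> (\<Union>\<A>) \<le> sum g \<A>" using div_P_bound A g C by blast
    also have "\<dots> \<le> (\<Sum>A\<in>\<A>. lowest C A + e / (real (card \<A>) + 1))"
      using g by (intro sum_mono) auto
    also have "\<dots> \<le> sum (lowest C) \<A> + e"
      using \<open>e > 0\<close> by (rule sum_add_fraction_le)
    finally show "\<delta> (\<Union>\<A>) \<le> sum (lowest C) \<A> + e" .
  qed
  also have "\<dots> = sum (restrict (lowest C) (Fpow X)) \<A>"
    by (rule sum_restrict_Fpow[OF A, symmetric])
  finally show "\<delta> (\<Union>\<A>) \<le> sum (restrict (lowest C) (Fpow X)) \<A>" .
next
  have "(\<lambda>f. f {}) ` C = {0}" using C by (force simp: div_P_def)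
  then show "restrict (lowest C) (Fpow X) {} = 0" by (simp add: Fpow_iff)
qed auto

lemma tight_span_below:
  assumes f: "f \<in> div_P X \<delta>"
  shows "\<exists>z\<in>tight_span X \<delta>. div_le X z f"
proof -
  define S where "S = {g \<in> div_P X \<delta>. div_le X g f}"
  have "\<exists>m\<in>S. \<forall>a\<in>S. div_le X a m \<longrightarrow> a = m"
  proof (rule predicate_Zorn)
    show "partial_order_on S (relation_of (\<lambda>a b. div_le X b a) S)"
    proof (rule partial_order_on_relation_ofI)
      fix a b assume "a \<in> S" "b \<in> S" "div_le X b a" "div_le X a b"
      then show "a = b"
        by (intro extensionalityI[of _ "Fpow X"]) (force simp: S_def div_P_def div_le_def)+
    qed (force simp: div_le_def)+
  next
    fix C assume ch: "C \<in> Chains (relation_of (\<lambda>a b. div_le X b a) S)"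
    then have C: "C \<subseteq> S" "\<And>g h. g \<in> C \<Longrightarrow> h \<in> C \<Longrightarrow> div_le X g h \<or> div_le X h g"
      by (auto simp: Chains_def relation_of_def)
    show "\<exists>u\<in>S. \<forall>a\<in>C. div_le X u a"
    proof (cases "C = {}")
      case True
      then show ?thesis using f by (auto simp: S_def div_le_def)
    next
      case False
      let ?u = "restrict (lowest C) (Fpow X)"
      have u: "?u \<in> div_P X \<delta>" using chain_Inf_in_div_P[of C] C False by (auto simp: S_def)
      have le: "div_le X ?u a" if "a \<in> C" for a
      proof -
        have "lowest C A \<le> a A" if "A \<in> Fpow X" for A
        proof (rule cINF_lower)
          show "bdd_below ((\<lambda>f. f A) ` C)"
            using C(1) that div_P_nonneg by (intro bdd_belowI2[of _ 0]) (auto simp: S_def)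
        qed fact
        then show ?thesis by (auto simp: div_le_def)
      qed
      obtain a where "a \<in> C" using False by blast
      then have "div_le X ?u f" using le[of a] C(1) by (force simp: S_def div_le_def)
      then show ?thesis using u le by (auto simp: S_def)
    qed
  qed
  then obtain m where m: "m \<in> S" "\<And>a. a \<in> S \<Longrightarrow> div_le X a m \<Longrightarrow> a = m" by blast
  have "g \<in> S" if "g \<in> div_P X \<delta>" "div_le X g m" for g
    using that m(1) by (force simp: S_def div_le_def)
  then show ?thesis using m by (auto simp: tight_span_def S_def)
qed

text \<open>
  If every \<open>\<D>\<close> left a slack of at least \<open>e\<close>, then lowering the single value \<open>g A\<close> by \<open>e\<close> would give
  a smaller element of \<open>P\<^sub>X\<close>.
\<close>

lemma tight_span_approx:
  assumes g: "g \<in> tight_span X \<delta>" and A: "A \<in> Fpow X" and e: "e > 0"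
  shows "\<exists>\<D>\<in>Fpow (Fpow X). g A - e < \<delta> (A \<union> \<Union>\<D>) - sum g \<D>"
proof (rule ccontr)
  assume contra: "\<not> ?thesis"
  have gP: "g \<in> div_P X \<delta>" using g by (simp add: tight_span_def)
  define h where "h = g(A := g A - e)"
  have no: "\<delta> (A \<union> \<Union>\<D>) - sum g \<D> \<le> h A" if "\<D> \<in> Fpow (Fpow X)" for \<D>
    using contra that by (force simp: h_def)
  have "A \<noteq> {}"
  proof
    assume "A = {}"
    then show False using no[of "{}"] e gP \<delta>_empty by (auto simp: h_def Fpow_iff div_P_def)
  qed
  have "h \<in> div_P X \<delta>"
  proof (rule div_P_I)
    show "h \<in> extensional (Fpow X)" using gP A by (auto simp: h_def div_P_def extensional_def)
    show "h {} = 0" using gP \<open>A \<noteq> {}\<close> by (auto simp: h_def div_P_def)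
    fix \<A> :: "'a set set" assume \<A>: "\<A> \<in> Fpow (Fpow X)"
    have hg: "sum h \<B> = sum g \<B>" if "A \<notin> \<B>" for \<B>
      using that by (intro sum.cong) (auto simp: h_def)
    show "\<delta> (\<Union>\<A>) \<le> sum h \<A>"
    proof (cases "A \<in> \<A>")
      case True
      let ?D = "\<A> - {A}"
      have "\<Union>\<A> = A \<union> \<Union>?D" using True by auto
      moreover have "sum h \<A> = h A + sum g ?D"
        using True \<A> hg[of ?D] by (simp add: Fpow_iff sum.remove)
      moreover have "?D \<in> Fpow (Fpow X)" using \<A> by (auto simp: Fpow_iff)
      ultimately show ?thesis using no[of ?D] by simp
    next
      case False
      then show ?thesis using hg div_P_bound[OF gP \<A>] by simp
    qed
  qed
  moreover have "div_le X h g" using e by (auto simp: h_def div_le_def)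
  ultimately have "h = g" using g by (auto simp: tight_span_def)
  then have "h A = g A" by simp
  then show False using e by (simp add: h_def)
qed

section \<open>The diversity on the tight span\<close>

lemma Fpow_tight_span: "F \<in> Fpow (tight_span X \<delta>) \<Longrightarrow> finite F \<and> F \<subseteq> div_P X \<delta>"
  by (auto simp: Fpow_iff tight_span_def)

lemma lowest_nonneg:
  assumes "F \<in> Fpow (tight_span X \<delta>)" "F \<noteq> {}" "A \<in> Fpow X"
  shows "0 \<le> lowest F A"
  using lowest_in[of F A] div_P_nonneg Fpow_tight_span assms by (metis subsetD)

lemma tight_span_div_ge:
  assumes F: "F \<in> Fpow (tight_span X \<delta>)" "F \<noteq> {}" and A: "\<A> \<in> Fpow (Fpow X)"
  shows "\<delta> (\<Union>\<A>) - sum (lowest F) \<A> \<le> tight_span_div X \<delta> F"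
proof -
  have "\<delta> (\<Union>\<A>) - sum (lowest F) \<A> \<le>
      (SUP \<A>\<in>{\<A>. finite \<A> \<and> \<A> \<subseteq> Fpow X}. \<delta> (\<Union>\<A>) - sum (lowest F) \<A>)"
    using tight_span_div_bdd_above[OF div] Fpow_tight_span[OF F(1)] F(2) A
    by (intro cSUP_upper) (auto simp: Fpow_iff)
  then show ?thesis using F by (simp add: tight_span_div_def)
qed

lemma tight_span_div_le:
  assumes "F \<noteq> {}" "\<And>\<A>. \<A> \<in> Fpow (Fpow X) \<Longrightarrow> \<delta> (\<Union>\<A>) - sum (lowest F) \<A> \<le> c"
  shows "tight_span_div X \<delta> F \<le> c"
  unfolding tight_span_div_def using assms
  by (auto simp: Fpow_iff intro!: cSUP_least)

text \<open>
  Prices only drop when \<open>F i\<close> is enlarged to the union, and they are non-negative, so a set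
  occurring in several of the families \<open>\<C> i\<close> may as well be paid for repeatedly.
\<close>

lemma tight_span_div_ge_family:
  assumes I: "finite I" "I \<noteq> {}"
    and F: "\<And>i. i \<in> I \<Longrightarrow> F i \<in> Fpow (tight_span X \<delta>)" "\<And>i. i \<in> I \<Longrightarrow> F i \<noteq> {}"
    and C: "\<And>i. i \<in> I \<Longrightarrow> \<C> i \<in> Fpow (Fpow X)"
  shows "\<delta> (\<Union>i\<in>I. \<Union>(\<C> i)) - (\<Sum>i\<in>I. sum (lowest (F i)) (\<C> i))
    \<le> tight_span_div X \<delta> (\<Union>i\<in>I. F i)"
proof -
  let ?G = "\<Union>i\<in>I. F i" and ?A = "\<Union>i\<in>I. \<C> i"
  have G: "?G \<in> Fpow (tight_span X \<delta>)" "?G \<noteq> {}" using I F by (auto simp: Fpow_iff)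
  have "?A \<in> Fpow (Fpow X)" using I C by (auto simp: Fpow_iff)
  from tight_span_div_ge[OF G this]
  have 1: "\<delta> (\<Union>?A) - sum (lowest ?G) ?A \<le> tight_span_div X \<delta> ?G" .
  have "sum (lowest ?G) ?A \<le> (\<Sum>i\<in>I. sum (lowest ?G) (\<C> i))"
    using I C by (intro sum_UNION_le lowest_nonneg[OF G]) (auto dest: Fpow_finite Fpow_memD)
  also have "\<dots> \<le> (\<Sum>i\<in>I. sum (lowest (F i)) (\<C> i))"
    using G F by (intro sum_mono lowest_antimono) (auto simp: Fpow_iff)
  moreover have "\<Union>?A = (\<Union>i\<in>I. \<Union>(\<C> i))" by auto
  ultimately show ?thesis using 1 by simp
qed

lemma tight_span_div_Un_ge:
  assumes "F \<in> Fpow (tight_span X \<delta>)" "F \<noteq> {}" "H \<in> Fpow (tight_span X \<delta>)" "H \<noteq> {}"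
    and "\<B> \<in> Fpow (Fpow X)" "\<C> \<in> Fpow (Fpow X)"
  shows "\<delta> (\<Union>\<B> \<union> \<Union>\<C>) - sum (lowest F) \<B> - sum (lowest H) \<C> \<le> tight_span_div X \<delta> (F \<union> H)"
  using tight_span_div_ge_family[of UNIV "\<lambda>b. if b then F else H" "\<lambda>b. if b then \<B> else \<C>"] assms
  by (simp add: UNIV_bool Un_commute algebra_simps)

text \<open>
  Each member of a family is priced by whichever of \<open>F\<close> and \<open>H\<close> is cheaper, so the supremum
  defining \<open>tight_span_div X \<delta> (F \<union> H)\<close> is governed by pairs of families.
\<close>

lemma tight_span_div_Un_le:
  assumes FH: "finite F" "F \<noteq> {}" "finite H" "H \<noteq> {}"
    and le: "\<And>\<B> \<C>. \<B> \<in> Fpow (Fpow X) \<Longrightarrow> \<C> \<in> Fpow (Fpow X) \<Longrightarrow>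
        \<delta> (\<Union>\<B> \<union> \<Union>\<C>) - sum (lowest F) \<B> - sum (lowest H) \<C> \<le> c"
  shows "tight_span_div X \<delta> (F \<union> H) \<le> c"
proof (rule tight_span_div_le)
  fix \<A> :: "'a set set" assume A: "\<A> \<in> Fpow (Fpow X)"
  define B where "B = {A\<in>\<A>. lowest F A \<le> lowest H A}"
  define C where "C = \<A> - B"
  have BC: "\<A> = B \<union> C" "B \<inter> C = {}" "B \<in> Fpow (Fpow X)" "C \<in> Fpow (Fpow X)"
    using A by (auto simp: B_def C_def Fpow_iff)
  have "sum (lowest (F \<union> H)) \<A> = sum (lowest (F \<union> H)) B + sum (lowest (F \<union> H)) C"
    using BC by (auto simp: Fpow_iff intro!: sum.union_disjoint)
  also have "sum (lowest (F \<union> H)) B = sum (lowest F) B"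
    by (intro sum.cong) (auto simp: B_def lowest_Un[OF FH(1,3,2,4)])
  also have "sum (lowest (F \<union> H)) C = sum (lowest H) C"
    by (intro sum.cong) (auto simp: B_def C_def lowest_Un[OF FH(1,3,2,4)])
  finally have "sum (lowest (F \<union> H)) \<A> = sum (lowest F) B + sum (lowest H) C" .
  moreover have "\<Union>\<A> = \<Union>B \<union> \<Union>C" using BC(1) by auto
  ultimately show "\<delta> (\<Union>\<A>) - sum (lowest (F \<union> H)) \<A> \<le> c"
    using le[OF BC(3,4)] by simp
qed (use FH in auto)

lemma tight_span_div_nonneg:
  assumes "F \<in> Fpow (tight_span X \<delta>)"
  shows "0 \<le> tight_span_div X \<delta> F"
proof (cases "F = {}")
  case False
  then show ?thesis using tight_span_div_ge[OF assms False, of "{}"] \<delta>_empty by (simp add: Fpow_iff)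
qed (simp add: tight_span_div_def)

lemma tight_span_div_mono:
  assumes "G \<in> Fpow (tight_span X \<delta>)" "F \<subseteq> G"
  shows "tight_span_div X \<delta> F \<le> tight_span_div X \<delta> G"
proof (cases "F = {}")
  case True
  then show ?thesis using tight_span_div_nonneg assms(1) by (simp add: tight_span_div_def)
next
  case False
  then have G: "G \<noteq> {}" "finite G" using assms by (auto simp: Fpow_iff)
  show ?thesis
  proof (rule tight_span_div_le[OF False])
    fix \<A> :: "'a set set" assume A: "\<A> \<in> Fpow (Fpow X)"
    have "sum (lowest G) \<A> \<le> sum (lowest F) \<A>"
      using G False assms by (intro sum_mono lowest_antimono) auto
    then show "\<delta> (\<Union>\<A>) - sum (lowest F) \<A> \<le> tight_span_div X \<delta> G"
      using tight_span_div_ge[OF assms(1) G(1) A] by simp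
  qed
qed

text \<open>
  If \<open>\<delta>\<^sub>T F\<close> vanishes, the pointwise minimum of \<open>F\<close> still lies in \<open>P\<^sub>X\<close>; lying below every element
  of \<open>F\<close>, it equals each of them by minimality.
\<close>

lemma tight_span_div_eq_0_iff:
  assumes F: "F \<in> Fpow (tight_span X \<delta>)"
  shows "tight_span_div X \<delta> F = 0 \<longleftrightarrow> card F \<le> 1"
proof
  assume z: "tight_span_div X \<delta> F = 0"
  show "card F \<le> 1"
  proof (cases "F = {}")
    case False
    let ?m = "restrict (lowest F) (Fpow X)"
    have "?m \<in> div_P X \<delta>"
    proof (rule div_P_I)
      have "lowest F {} = 0"
        using lowest_in[of F "{}"] Fpow_tight_span[OF F] False by (auto simp: div_P_def)
      then show "?m {} = 0" by (simp add: Fpow_iff)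
      fix \<A> :: "'a set set" assume A: "\<A> \<in> Fpow (Fpow X)"
      have "sum ?m \<A> = sum (lowest F) \<A>" using A by (rule sum_restrict_Fpow)
      then show "\<delta> (\<Union>\<A>) \<le> sum ?m \<A>" using tight_span_div_ge[OF F False A] z by simp
    qed auto
    then have "?m = f" if "f \<in> F" for f
      using that F lowest_le[of F f] by (auto simp: Fpow_iff tight_span_def div_le_def)
    then have "F \<subseteq> {?m}" by auto
    then have "card F \<le> card {?m}" by (intro card_mono) auto
    then show ?thesis by simp
  qed auto
next
  assume card: "card F \<le> 1"
  have "tight_span_div X \<delta> F \<le> 0"
  proof (cases "F = {}")
    case False
    then obtain f where f: "F = {f}" using card F
      by (metis Fpow_finite card_0_eq card_1_singletonE le_neq_implies_less less_one)
    then show ?thesis using F div_P_bound[of f]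
      by (intro tight_span_div_le) (auto simp: Fpow_iff tight_span_def)
  qed (simp add: tight_span_div_def)
  then show "tight_span_div X \<delta> F = 0" using tight_span_div_nonneg[OF F] by simp
qed

lemma tight_span_div_triangle_point:
  assumes F: "F \<in> Fpow (tight_span X \<delta>)" "F \<noteq> {}" and H: "H \<in> Fpow (tight_span X \<delta>)" "H \<noteq> {}"
    and g: "g \<in> tight_span X \<delta>"
  shows "tight_span_div X \<delta> (F \<union> H) \<le> tight_span_div X \<delta> (F \<union> {g}) + tight_span_div X \<delta> (H \<union> {g})"
proof (rule tight_span_div_Un_le)
  fix \<B> \<C> :: "'a set set" assume BC: "\<B> \<in> Fpow (Fpow X)" "\<C> \<in> Fpow (Fpow X)"
  have G: "{g} \<in> Fpow (tight_span X \<delta>)" using g by (simp add: Fpow_iff)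
  have b: "\<Union>\<B> \<in> Fpow X" "{\<Union>\<B>} \<in> Fpow (Fpow X)"
    using Union_Fpow[OF BC(1)] by (auto simp: Fpow_iff)
  \<comment> \<open>On the \<open>H\<close> side all of \<open>\<B>\<close> is replaced by its union, at price \<open>g (\<Union>\<B>)\<close>.\<close>
  have right: "\<delta> (\<Union>\<B> \<union> \<Union>\<C>) - sum (lowest H) \<C> - g (\<Union>\<B>) \<le> tight_span_div X \<delta> (H \<union> {g})"
    using tight_span_div_Un_ge[OF H G _ BC(2) b(2)] by (simp add: Un_commute)
  have left: "g (\<Union>\<B>) - sum (lowest F) \<B> \<le> tight_span_div X \<delta> (F \<union> {g})"
  proof (rule field_le_epsilon)
    fix e :: real assume "e > 0"
    then obtain \<D> where D: "\<D> \<in> Fpow (Fpow X)" "g (\<Union>\<B>) - e < \<delta> (\<Union>\<B> \<union> \<Union>\<D>) - sum g \<D>"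
      using tight_span_approx[OF g b(1)] by blast
    then show "g (\<Union>\<B>) - sum (lowest F) \<B> \<le> tight_span_div X \<delta> (F \<union> {g}) + e"
      using tight_span_div_Un_ge[OF F G _ BC(1) D(1)] by simp
  qed
  from left right
  show "\<delta> (\<Union>\<B> \<union> \<Union>\<C>) - sum (lowest F) \<B> - sum (lowest H) \<C>
      \<le> tight_span_div X \<delta> (F \<union> {g}) + tight_span_div X \<delta> (H \<union> {g})"
    by simp
qed (use F H in \<open>auto simp: Fpow_iff\<close>)

lemma diversity_tight_span: "diversity (tight_span X \<delta>) (tight_span_div X \<delta>)"
  unfolding diversity_def
proof (intro conjI ballI impI)
  let ?d = "tight_span_div X \<delta>" and ?T = "tight_span X \<delta>"
  fix F G H assume F: "F \<in> Fpow ?T" and G: "G \<in> Fpow ?T" "G \<noteq> {}" and H: "H \<in> Fpow ?T"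
  have FG: "F \<union> G \<in> Fpow ?T" "G \<union> H \<in> Fpow ?T" using F G H by (auto simp: Fpow_iff)
  obtain g where g: "g \<in> G" using G by blast
  show "?d (F \<union> H) \<le> ?d (F \<union> G) + ?d (G \<union> H)"
  proof (cases "F = {} \<or> H = {}")
    case True
    then show ?thesis
      using tight_span_div_mono[OF FG(1), of F] tight_span_div_mono[OF FG(2), of H]
        tight_span_div_nonneg[OF FG(1)] tight_span_div_nonneg[OF FG(2)] by auto
  next
    case False
    then have "?d (F \<union> H) \<le> ?d (F \<union> {g}) + ?d (H \<union> {g})"
      using g G by (intro tight_span_div_triangle_point F H) (auto simp: Fpow_iff)
    also have "\<dots> \<le> ?d (F \<union> G) + ?d (G \<union> H)"
      using g FG by (intro add_mono tight_span_div_mono) auto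
    finally show ?thesis .
  qed
qed (auto simp: tight_span_div_nonneg tight_span_div_eq_0_iff)

section \<open>Hyperconvexity\<close>

context
  fixes r :: "('a set \<Rightarrow> real) set \<Rightarrow> real"
  assumes r: "\<And>\<F>. \<F> \<in> Fpow (Fpow (tight_span X \<delta>)) \<Longrightarrow> tight_span_div X \<delta> (\<Union>\<F>) \<le> sum r \<F>"
begin

lemma r_ge: "F \<in> Fpow (tight_span X \<delta>) \<Longrightarrow> tight_span_div X \<delta> F \<le> r F"
  using r[of "{F}"] by (simp add: Fpow_iff)

lemma r_nonneg: "F \<in> Fpow (tight_span X \<delta>) \<Longrightarrow> 0 \<le> r F"
  using r_ge tight_span_div_nonneg by fastforce

lemma cover_cost_le:
  assumes "F \<in> Fpow (tight_span X \<delta>)" "F \<noteq> {}" "\<C> \<in> Fpow (Fpow X)"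
  shows "cover_cost X (tight_span X \<delta>) r (\<Union>\<C>) \<le> r F + sum (lowest F) \<C>"
proof -
  let ?K = "\<lambda>D. {(F, \<C>). F \<in> Fpow (tight_span X \<delta>) \<and> F \<noteq> {} \<and> \<C> \<in> Fpow (Fpow X) \<and> \<Union>\<C> = D}"
  have nn: "0 \<le> r F + sum (lowest F) \<C>"
    if "F \<in> Fpow (tight_span X \<delta>)" "F \<noteq> {}" "\<C> \<in> Fpow (Fpow X)" for F \<C>
    using that by (intro add_nonneg_nonneg sum_nonneg lowest_nonneg r_nonneg) (auto dest: Fpow_memD)
  have "(INF (F, \<C>)\<in>?K (\<Union>\<C>). r F + sum (lowest F) \<C>)
      \<le> (case (F, \<C>) of (F, \<C>) \<Rightarrow> r F + sum (lowest F) \<C>)"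
    using assms nn by (intro cINF_lower bdd_belowI2[of _ 0]) auto
  then show ?thesis using nn assms Union_Fpow[OF assms(3)] by (auto simp: cover_cost_def)
qed

lemma cover_cost_approx:
  assumes "D \<in> Fpow X" "D \<noteq> {}" "e > 0"
  shows "\<exists>F \<C>. F \<in> Fpow (tight_span X \<delta>) \<and> F \<noteq> {} \<and> \<C> \<in> Fpow (Fpow X) \<and> \<Union>\<C> = D \<and>
    r F + sum (lowest F) \<C> < cover_cost X (tight_span X \<delta>) r D + e"
proof -
  let ?K = "{(F, \<C>). F \<in> Fpow (tight_span X \<delta>) \<and> F \<noteq> {} \<and> \<C> \<in> Fpow (Fpow X) \<and> \<Union>\<C> = D}"
  obtain f where "f \<in> tight_span X \<delta>" using div_P_nonempty tight_span_below by blast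
  then have "({f}, {D}) \<in> ?K" using assms by (auto simp: Fpow_iff)
  then have "\<exists>y\<in>(\<lambda>(F, \<C>). r F + sum (lowest F) \<C>) ` ?K.
      y < (INF (F, \<C>)\<in>?K. r F + sum (lowest F) \<C>) + e"
    using assms by (intro cInf_lessD) auto
  then show ?thesis using assms by (auto simp: cover_cost_def)
qed

text \<open>
  Near-optimal covers of the members of \<open>\<A>\<close> merge into one family priced by the union of all the
  chosen \<open>F\<close>, and admissibility of \<open>r\<close> pays for the diversity of that union.
\<close>

lemma cover_cost_in_div_P: "cover_cost X (tight_span X \<delta>) r \<in> div_P X \<delta>"
proof (rule div_P_I)
  let ?\<rho> = "cover_cost X (tight_span X \<delta>) r"
  show "?\<rho> \<in> extensional (Fpow X)" by (simp add: cover_cost_def)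
  show 0: "?\<rho> {} = 0" by (simp add: cover_cost_def Fpow_iff)
  fix \<A>0 :: "'a set set" assume A0: "\<A>0 \<in> Fpow (Fpow X)"
  define \<A> where "\<A> = \<A>0 - {{}}"
  have A: "finite \<A>" "\<And>A. A \<in> \<A> \<Longrightarrow> A \<in> Fpow X \<and> A \<noteq> {}"
    using A0 by (auto simp: \<A>_def dest: Fpow_finite Fpow_memD)
  have sum0: "sum ?\<rho> \<A>0 = sum ?\<rho> \<A>"
    unfolding \<A>_def using A0 0 by (intro sum.mono_neutral_right) (auto simp: Fpow_iff)
  have un0: "\<Union>\<A>0 = \<Union>\<A>" by (auto simp: \<A>_def)
  have "\<delta> (\<Union>\<A>) \<le> sum ?\<rho> \<A>"
  proof (cases "\<A> = {}")
    case True
    then show ?thesis using \<delta>_empty by simp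
  next
    case False
    show ?thesis
    proof (rule field_le_epsilon)
      fix e :: real assume e: "e > 0"
      let ?e = "e / (real (card \<A>) + 1)"
      have "\<forall>A\<in>\<A>. \<exists>F \<C>. F \<in> Fpow (tight_span X \<delta>) \<and> F \<noteq> {} \<and> \<C> \<in> Fpow (Fpow X) \<and> \<Union>\<C> = A \<and>
          r F + sum (lowest F) \<C> < ?\<rho> A + ?e"
        using cover_cost_approx A e by simp
      then obtain F \<C> where FC: "\<And>A. A \<in> \<A> \<Longrightarrow> F A \<in> Fpow (tight_span X \<delta>) \<and> F A \<noteq> {} \<and>
          \<C> A \<in> Fpow (Fpow X) \<and> \<Union>(\<C> A) = A \<and> r (F A) + sum (lowest (F A)) (\<C> A) < ?\<rho> A + ?e"
        by metis
      have "\<Union>\<A> = (\<Union>A\<in>\<A>. \<Union>(\<C> A))" using FC by auto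
      then have "\<delta> (\<Union>\<A>) - (\<Sum>A\<in>\<A>. sum (lowest (F A)) (\<C> A))
          \<le> tight_span_div X \<delta> (\<Union>(F ` \<A>))"
        using tight_span_div_ge_family[of \<A> F \<C>] A(1) False FC by simp
      also have "\<dots> \<le> sum r (F ` \<A>)" using A FC by (intro r) (auto simp: Fpow_iff)
      also have "\<dots> \<le> (\<Sum>A\<in>\<A>. r (F A))"
        using sum_image_le[of \<A> r F] A FC r_nonneg by (simp add: o_def)
      finally have "\<delta> (\<Union>\<A>) \<le> (\<Sum>A\<in>\<A>. r (F A) + sum (lowest (F A)) (\<C> A))"
        by (simp add: sum.distrib)
      also have "\<dots> \<le> (\<Sum>A\<in>\<A>. ?\<rho> A + ?e)" using FC by (intro sum_mono) force
      also have "\<dots> \<le> sum ?\<rho> \<A> + e" using e by (rule sum_add_fraction_le)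
      finally show "\<delta> (\<Union>\<A>) \<le> sum ?\<rho> \<A> + e" .
    qed
  qed
  then show "\<delta> (\<Union>\<A>0) \<le> sum ?\<rho> \<A>0" by (simp add: sum0 un0)
qed

lemma hyperconvex_point:
  "\<exists>z\<in>tight_span X \<delta>. \<forall>F\<in>Fpow (tight_span X \<delta>). tight_span_div X \<delta> ({z} \<union> F) \<le> r F"
proof -
  let ?\<rho> = "cover_cost X (tight_span X \<delta>) r"
  obtain z where z: "z \<in> tight_span X \<delta>" "div_le X z ?\<rho>"
    using tight_span_below[OF cover_cost_in_div_P] by blast
  then have zP: "z \<in> div_P X \<delta>" by (simp add: tight_span_def)
  have "tight_span_div X \<delta> ({z} \<union> F) \<le> r F" if F: "F \<in> Fpow (tight_span X \<delta>)" for F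
  proof (cases "F = {}")
    case True
    have "tight_span_div X \<delta> {z} = 0" using z by (subst tight_span_div_eq_0_iff) (auto simp: Fpow_iff)
    then show ?thesis using True r_nonneg[OF F] by simp
  next
    case False
    show ?thesis
    proof (rule tight_span_div_Un_le)
      fix \<B> \<C> :: "'a set set" assume BC: "\<B> \<in> Fpow (Fpow X)" "\<C> \<in> Fpow (Fpow X)"
      have c: "\<Union>\<C> \<in> Fpow X" using Union_Fpow[OF BC(2)] .
      \<comment> \<open>All of \<open>\<C>\<close> is bought from \<open>z\<close> as one set, which is no dearer than paying \<open>r F\<close> and using \<open>F\<close>.\<close>
      have "\<delta> (\<Union>\<B> \<union> \<Union>\<C>) = \<delta> (\<Union>(insert (\<Union>\<C>) \<B>))" by (simp add: Un_commute)
      also have "\<dots> \<le> sum z (insert (\<Union>\<C>) \<B>)"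
        using BC c by (intro div_P_bound zP) (auto simp: Fpow_iff)
      also have "\<dots> \<le> sum z \<B> + z (\<Union>\<C>)"
        using BC div_P_nonneg[OF zP c] by (simp add: sum.insert_if Fpow_iff)
      also have "z (\<Union>\<C>) \<le> ?\<rho> (\<Union>\<C>)" using z c by (simp add: div_le_def)
      also have "\<dots> \<le> r F + sum (lowest F) \<C>" using cover_cost_le[OF F False BC(2)] .
      finally show "\<delta> (\<Union>\<B> \<union> \<Union>\<C>) - sum (lowest {z}) \<B> - sum (lowest F) \<C> \<le> r F" by simp
    qed (use F False in \<open>auto simp: Fpow_iff\<close>)
  qed
  then show ?thesis using z by blast
qed

end

lemma hyperconvex_tight_span: "hyperconvex (tight_span X \<delta>) (tight_span_div X \<delta>)"
  unfolding hyperconvex_def using hyperconvex_point by (simp add: Fpow_iff)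

end

theorem theorem3p6:
  fixes X :: "'a set" and \<delta> :: "'a set \<Rightarrow> real"
  assumes "diversity X \<delta>"
  shows "diversity (tight_span X \<delta>) (tight_span_div X \<delta>) \<and>
         hyperconvex (tight_span X \<delta>) (tight_span_div X \<delta>)"
  using diversity_tight_span[OF assms] hyperconvex_tight_span[OF assms] by blast

end
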